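(* Let $G$ be a finite undirected graph (multiple edges and loops allowed), let $v\in V(G)$, and let $\mathcal I$ be the poset of ideals of $\mathrm{Tisg}(G,v)$ ordered by inclusion. Then $\mathcal I$ is semimodular, but if $G$ is connected and contains more than $2$ vertices, then $\mathcal I$ is not atomic.
   Context: Graphs are finite and undirected and may have multiple edges and loops. For $X\subseteq V(G)$, $G[X]$ is the subgraph of $G$ induced by $X$. A $v$-rooted tree induced subgraph of $G$ is a subgraph $H=G[V(T)]$ for some tree $T$ in $G$ rooted at $v$. $\mathrm{Tisg}(G,v)$ is the set of all graph isomorphisms $\varphi:H\to J$ (bijections on vertices and on edges preserving incidence) with $H,J$ $v$-rooted tree induced subgraphs of $G$ and $\varphi(v)=v$. For $\varphi,\psi\in\mathrm{Tisg}(G,v)$, let $C_{\psi\circ\varphi}$ be the subgraph of $G$ induced by the set of all vertices $u$ for which there is a path from $v$ to $u$ contained in both $\mathrm{Im}(\varphi)$ and $\mathrm{Dom}(\psi)$; the product $\psi\circ\varphi:\varphi^{-1}(C_{\psi\circ\varphi})\to\psi(C_{\psi\circ\varphi})$ is the restriction of "apply $\varphi$, then $\psi$" to $\varphi^{-1}(C_{\psi\circ\varphi})$. An ideal of a semigroup $S$ is a subset $I\subseteq S$ with $SI\subseteq I$ and $IS\subseteq I$. The poset of ideals is a lattice with meet $\cap$ and join $\cup$. A lattice is semimodular if, for all $A,B$, whenever $A$ covers $A\wedge B$, then $A\vee B$ covers $B$. A finite lattice is atomic if every element is a join of atoms (elements covering the least element; the least element is the empty join). *)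

theory Defs
  imports "HOL-Algebra.Lattice"
begin

section \<open>Finite undirected multigraphs\<close>

text \<open>Edges have their own identity, so parallel edges are possible; a loop is an edge whose
  set of ends is a singleton.\<close>

record ('v, 'e) mgraph =
  verts :: "'v set"
  edges :: "'e set"
  ends  :: "'e \<Rightarrow> 'v set"

definition finite_mgraph :: "('v, 'e) mgraph \<Rightarrow> bool" where
  "finite_mgraph G \<longleftrightarrow> finite (verts G) \<and> finite (edges G) \<and>
     (\<forall>e\<in>edges G. ends G e \<subseteq> verts G \<and> (card (ends G e) = 1 \<or> card (ends G e) = 2))"

text \<open>Only the values of \<^term>\<open>ends G\<close> on \<^term>\<open>edges G\<close> matter; subgraphs simply keep the whole
  function.\<close>

definition subgraph :: "('v, 'e) mgraph \<Rightarrow> ('v, 'e) mgraph \<Rightarrow> bool" where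
  "subgraph H G \<longleftrightarrow> verts H \<subseteq> verts G \<and> edges H \<subseteq> edges G \<and> ends H = ends G \<and>
     (\<forall>e\<in>edges H. ends H e \<subseteq> verts H)"

definition induced :: "('v, 'e) mgraph \<Rightarrow> 'v set \<Rightarrow> ('v, 'e) mgraph" where
  "induced G X = \<lparr>verts = X, edges = {e \<in> edges G. ends G e \<subseteq> X}, ends = ends G\<rparr>"

definition walk :: "('v, 'e) mgraph \<Rightarrow> 'v list \<Rightarrow> 'e list \<Rightarrow> bool" where
  "walk G vs es \<longleftrightarrow> length vs = Suc (length es) \<and> set vs \<subseteq> verts G \<and> set es \<subseteq> edges G \<and>
     (\<forall>i<length es. ends G (es ! i) = {vs ! i, vs ! Suc i})"

definition path :: "('v, 'e) mgraph \<Rightarrow> 'v list \<Rightarrow> 'e list \<Rightarrow> bool" where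
  "path G vs es \<longleftrightarrow> walk G vs es \<and> distinct vs"

text \<open>A loop is a cycle of length one, and two parallel edges form a cycle of length two.\<close>

definition cycle :: "('v, 'e) mgraph \<Rightarrow> 'v list \<Rightarrow> 'e list \<Rightarrow> bool" where
  "cycle G vs es \<longleftrightarrow> walk G vs es \<and> es \<noteq> [] \<and> hd vs = last vs \<and> distinct (tl vs) \<and> distinct es"

definition connected_mgraph :: "('v, 'e) mgraph \<Rightarrow> bool" where
  "connected_mgraph G \<longleftrightarrow> verts G \<noteq> {} \<and>
     (\<forall>u\<in>verts G. \<forall>w\<in>verts G. \<exists>vs es. path G vs es \<and> hd vs = u \<and> last vs = w)"

definition tree :: "('v, 'e) mgraph \<Rightarrow> bool" where
  "tree T \<longleftrightarrow> connected_mgraph T \<and> (\<nexists>vs es. cycle T vs es)"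

definition rooted_tree_induced_subgraph ::
    "('v, 'e) mgraph \<Rightarrow> 'v \<Rightarrow> ('v, 'e) mgraph \<Rightarrow> bool" where
  "rooted_tree_induced_subgraph G v H \<longleftrightarrow>
     (\<exists>T. subgraph T G \<and> tree T \<and> v \<in> verts T \<and> H = induced G (verts T))"


section \<open>The semigroup of partial isomorphisms\<close>

text \<open>An isomorphism between subgraphs is a pair of partial maps, on vertices and on edges; their
  domains and ranges record the source and the target graph.\<close>

type_synonym ('v, 'e) pmor = "('v \<rightharpoonup> 'v) \<times> ('e \<rightharpoonup> 'e)"

definition graph_iso ::
    "('v, 'e) pmor \<Rightarrow> ('v, 'e) mgraph \<Rightarrow> ('v, 'e) mgraph \<Rightarrow> bool" where
  "graph_iso \<phi> H J \<longleftrightarrow>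
     dom (fst \<phi>) = verts H \<and> bij_betw (\<lambda>x. the (fst \<phi> x)) (verts H) (verts J) \<and>
     dom (snd \<phi>) = edges H \<and> bij_betw (\<lambda>e. the (snd \<phi> e)) (edges H) (edges J) \<and>
     (\<forall>e\<in>edges H. ends J (the (snd \<phi> e)) = (\<lambda>x. the (fst \<phi> x)) ` ends H e)"

definition Tisg :: "('v, 'e) mgraph \<Rightarrow> 'v \<Rightarrow> ('v, 'e) pmor set" where
  "Tisg G v = {\<phi>. \<exists>H J. rooted_tree_induced_subgraph G v H \<and>
     rooted_tree_induced_subgraph G v J \<and> graph_iso \<phi> H J \<and> fst \<phi> v = Some v}"

definition Dom_graph :: "('v, 'e) mgraph \<Rightarrow> ('v, 'e) pmor \<Rightarrow> ('v, 'e) mgraph" where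
  "Dom_graph G \<phi> = \<lparr>verts = dom (fst \<phi>), edges = dom (snd \<phi>), ends = ends G\<rparr>"

definition Im_graph :: "('v, 'e) mgraph \<Rightarrow> ('v, 'e) pmor \<Rightarrow> ('v, 'e) mgraph" where
  "Im_graph G \<phi> = \<lparr>verts = ran (fst \<phi>), edges = ran (snd \<phi>), ends = ends G\<rparr>"

definition comp_core ::
    "('v, 'e) mgraph \<Rightarrow> 'v \<Rightarrow> ('v, 'e) pmor \<Rightarrow> ('v, 'e) pmor \<Rightarrow> ('v, 'e) mgraph" where
  "comp_core G v \<psi> \<phi> = induced G
     {u. \<exists>vs es. path (Im_graph G \<phi>) vs es \<and> path (Dom_graph G \<psi>) vs es \<and>
           hd vs = v \<and> last vs = u}"

text \<open>\<^term>\<open>tisg_mult G v \<psi> \<phi>\<close> is the product \<open>\<psi> \<circ> \<phi>\<close>: first \<open>\<phi>\<close>, then \<open>\<psi>\<close>.\<close>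

definition tisg_mult ::
    "('v, 'e) mgraph \<Rightarrow> 'v \<Rightarrow> ('v, 'e) pmor \<Rightarrow> ('v, 'e) pmor \<Rightarrow> ('v, 'e) pmor" where
  "tisg_mult G v \<psi> \<phi> =
     ((fst \<psi> \<circ>\<^sub>m fst \<phi>) |` {x. \<exists>y\<in>verts (comp_core G v \<psi> \<phi>). fst \<phi> x = Some y},
      (snd \<psi> \<circ>\<^sub>m snd \<phi>) |` {e. \<exists>f\<in>edges (comp_core G v \<psi> \<phi>). snd \<phi> e = Some f})"


section \<open>Ideals, semimodular and atomic lattices\<close>

text \<open>The empty set counts as an ideal.\<close>

definition semigroup_ideal :: "'a set \<Rightarrow> ('a \<Rightarrow> 'a \<Rightarrow> 'a) \<Rightarrow> 'a set \<Rightarrow> bool" where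
  "semigroup_ideal S m I \<longleftrightarrow> I \<subseteq> S \<and> (\<forall>s\<in>S. \<forall>x\<in>I. m s x \<in> I) \<and> (\<forall>x\<in>I. \<forall>s\<in>S. m x s \<in> I)"

definition ideal_poset :: "('v, 'e) mgraph \<Rightarrow> 'v \<Rightarrow> ('v, 'e) pmor set gorder" where
  "ideal_poset G v = \<lparr>carrier = {I. semigroup_ideal (Tisg G v) (tisg_mult G v) I},
     eq = (=), le = (\<subseteq>)\<rparr>"

definition covers :: "('a, 'b) gorder_scheme \<Rightarrow> 'a \<Rightarrow> 'a \<Rightarrow> bool" where
  "covers L a b \<longleftrightarrow> a \<in> carrier L \<and> b \<in> carrier L \<and> b \<sqsubset>\<^bsub>L\<^esub> a \<and>
     \<not> (\<exists>c\<in>carrier L. b \<sqsubset>\<^bsub>L\<^esub> c \<and> c \<sqsubset>\<^bsub>L\<^esub> a)"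

definition semimodular_lattice :: "('a, 'b) gorder_scheme \<Rightarrow> bool" where
  "semimodular_lattice L \<longleftrightarrow> lattice L \<and>
     (\<forall>a\<in>carrier L. \<forall>b\<in>carrier L.
        covers L a (a \<sqinter>\<^bsub>L\<^esub> b) \<longrightarrow> covers L (a \<squnion>\<^bsub>L\<^esub> b) b)"

definition atoms :: "('a, 'b) gorder_scheme \<Rightarrow> 'a set" where
  "atoms L = {a. covers L a \<bottom>\<^bsub>L\<^esub>}"

text \<open>Finiteness and the lattice property are deliberately not part of this predicate, so that
  its negation says exactly that some element is not a join of atoms.\<close>

definition atomic_lattice :: "('a, 'b) gorder_scheme \<Rightarrow> bool" where
  "atomic_lattice L \<longleftrightarrow> (\<forall>x\<in>carrier L. \<exists>A\<subseteq>atoms L. least L x (Upper L A))"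

end

theory Submission
  imports Defs
begin

text \<open>Ideals are closed under unions and intersections, so they form a distributive sublattice
  of the power set; semimodularity follows by intersecting an intermediate ideal between \<open>B\<close> and
  \<open>A \<union> B\<close> with \<open>A\<close>. The maps whose domain has \<open>v\<close> as its only vertex form an ideal \<open>J\<close>, which
  meets every nonempty ideal: multiply by the identity on \<open>v\<close>. Hence every atom lies in \<open>J\<close>, and
  the identity of a connected \<open>G\<close> with a second vertex lies in no join of atoms. What requires work
  is that the product of two maps is again a map between rooted tree induced subgraphs; these are
  just the connected induced subgraphs containing \<open>v\<close>, because a connected graph has a spanning
  tree.\<close>

section \<open>Connectivity\<close>

text \<open>Adjacency is taken as a relation so that reachability becomes its reflexive transitive
  closure. Monotonicity and induction along that closure then stand in for handling vertex and edge
  lists. Demanding that both ends be vertices keeps whatever is reachable from a vertex inside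
  \<open>H\<close>.\<close>

definition step :: "('v, 'e) mgraph \<Rightarrow> ('v \<times> 'v) set" where
  "step H = {(x, y). x \<in> verts H \<and> y \<in> verts H \<and> (\<exists>e\<in>edges H. ends H e = {x, y})}"

lemma sym_step: "sym (step H)"
  unfolding step_def sym_def by (auto simp: insert_commute)

lemma sym_step_rtrancl: "(x, y) \<in> (step H)\<^sup>* \<Longrightarrow> (y, x) \<in> (step H)\<^sup>*"
  using sym_rtrancl[OF sym_step] by (meson symD)

lemma step_mono:
  assumes "verts H \<subseteq> verts J" "edges H \<subseteq> edges J" "ends H = ends J"
  shows "step H \<subseteq> step J"
  using assms unfolding step_def by auto

lemma step_rtrancl_verts: "(x, y) \<in> (step H)\<^sup>* \<Longrightarrow> x \<in> verts H \<Longrightarrow> y \<in> verts H"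
  by (induction rule: rtrancl_induct) (auto simp: step_def)

lemma walk_step_nth:
  assumes "walk H vs es" "i < length es"
  shows "(vs ! i, vs ! Suc i) \<in> step H"
proof -
  have "vs ! i \<in> set vs" "vs ! Suc i \<in> set vs" "es ! i \<in> set es"
    using assms unfolding walk_def by (auto intro!: nth_mem)
  then show ?thesis
    using assms unfolding walk_def step_def by (auto intro!: bexI[of _ "es ! i"])
qed

lemma walk_rtrancl:
  assumes "walk H vs es"
  shows "(hd vs, last vs) \<in> (step H)\<^sup>*"
proof -
  have "(vs ! 0, vs ! i) \<in> (step H)\<^sup>*" if "i \<le> length es" for i
    using that
  proof (induction i)
    case (Suc i)
    then show ?case using walk_step_nth[OF assms, of i]
      by (meson Suc_le_lessD rtrancl.rtrancl_into_rtrancl less_imp_le)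
  qed simp
  moreover have "vs \<noteq> []" "last vs = vs ! length es" "hd vs = vs ! 0"
    using assms last_conv_nth[of vs] hd_conv_nth[of vs] unfolding walk_def by fastforce+
  ultimately show ?thesis by simp
qed

lemma walk_take:
  assumes "walk H vs es" "i < length vs"
  shows "walk H (take (Suc i) vs) (take i es)"
  using assms set_take_subset[of "Suc i" vs] set_take_subset[of i es]
  unfolding walk_def by auto

lemma walk_snoc:
  assumes "walk H vs es" "w \<in> verts H" "e \<in> edges H" "ends H e = {last vs, w}"
  shows "walk H (vs @ [w]) (es @ [e])"
proof -
  have "last vs = vs ! length es" "vs \<noteq> []"
    using assms(1) last_conv_nth[of vs] unfolding walk_def by fastforce+
  then show ?thesis
    using assms unfolding walk_def by (auto simp: nth_append less_Suc_eq)
qed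

lemma rtrancl_path:
  assumes "(u, w) \<in> (step H)\<^sup>*" "u \<in> verts H"
  shows "\<exists>vs es. path H vs es \<and> hd vs = u \<and> last vs = w"
  using assms
proof (induction rule: rtrancl_induct)
  case base
  then have "path H [u] []" by (auto simp: path_def walk_def)
  then show ?case by force
next
  case (step y z)
  then obtain vs es where p: "path H vs es" "hd vs = u" "last vs = y" by auto
  obtain e where e: "e \<in> edges H" "ends H e = {y, z}" "z \<in> verts H"
    using step.hyps by (auto simp: step_def)
  have ne: "vs \<noteq> []" using p by (auto simp: path_def walk_def)
  show ?case
  \<comment> \<open>A vertex that the path has visited already would spoil distinctness, so the path
    is cut at \<open>z\<close> instead of being extended.\<close>
  proof (cases "z \<in> set vs")
    case True
    then obtain i where i: "i < length vs" "vs ! i = z" by (auto simp: in_set_conv_nth)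
    then have "path H (take (Suc i) vs) (take i es)"
      using p walk_take by (auto simp: path_def)
    moreover have "hd (take (Suc i) vs) = u" using p by simp
    moreover have "last (take (Suc i) vs) = z"
      using i by (simp add: take_Suc_conv_app_nth)
    ultimately show ?thesis by blast
  next
    case False
    then have "path H (vs @ [z]) (es @ [e])"
      using p e walk_snoc[of H vs es z e] by (auto simp: path_def)
    then show ?thesis using p ne by (metis hd_append2 last_snoc)
  qed
qed

text \<open>Reachability is symmetric, so any two vertices are joined through the root
  \<open>v\<close>, and a chain of steps can be shortened to a path. All later connectivity
  arguments use this rooted form.\<close>

lemma connected_mgraph_iff:
  assumes "v \<in> verts H"
  shows "connected_mgraph H \<longleftrightarrow> (\<forall>u\<in>verts H. (v, u) \<in> (step H)\<^sup>*)"
proof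
  assume "connected_mgraph H"
  then show "\<forall>u\<in>verts H. (v, u) \<in> (step H)\<^sup>*"
    using assms walk_rtrancl[of H] unfolding connected_mgraph_def path_def by metis
next
  assume r: "\<forall>u\<in>verts H. (v, u) \<in> (step H)\<^sup>*"
  have "(u, w) \<in> (step H)\<^sup>*" if "u \<in> verts H" "w \<in> verts H" for u w
    using that r by (meson rtrancl_trans sym_step_rtrancl)
  then show "connected_mgraph H"
    unfolding connected_mgraph_def using assms rtrancl_path[of _ _ H] by fast
qed

text \<open>As long as there is a cycle, its first edge can be deleted: the rest of the cycle still
  joins the two ends of that edge.\<close>

lemma ex_spanning_tree:
  assumes "finite (edges H)" "connected_mgraph H" "\<forall>e\<in>edges H. ends H e \<subseteq> verts H"
  shows "\<exists>T. subgraph T H \<and> tree T \<and> verts T = verts H"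
  using assms
proof (induction "card (edges H)" arbitrary: H rule: less_induct)
  case less
  show ?case
  proof (cases "\<exists>vs es. cycle H vs es")
    case False
    then have "tree H" "subgraph H H" using less.prems by (auto simp: tree_def subgraph_def)
    then show ?thesis by blast
  next
    case True
    then obtain vs es where c: "cycle H vs es" by blast
    then obtain e es' where es: "es = e # es'" by (cases es) (auto simp: cycle_def)
    \<comment> \<open>A cycle has at least one edge, hence its vertex list has at least two entries;
      for a loop they coincide.\<close>
    obtain x y ws where vs: "vs = x # y # ws"
      using c unfolding cycle_def walk_def es by (cases vs; cases "tl vs") auto
    define H' where "H' = \<lparr>verts = verts H, edges = edges H - {e}, ends = ends H\<rparr>"
    have e: "e \<in> edges H" "ends H e = {x, y}"
      using c unfolding cycle_def walk_def es vs by auto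
    \<comment> \<open>Distinctness of the edges keeps \<open>e\<close> out of \<open>es'\<close>, so
      the rest of the cycle survives in \<open>H'\<close>. For a loop this rest is the walk with a
      single vertex.\<close>
    have "walk H' (y # ws) es'"
      using c unfolding cycle_def walk_def es vs H'_def by auto
    moreover have "last (y # ws) = x" using c unfolding cycle_def vs by auto
    ultimately have yx: "(y, x) \<in> (step H')\<^sup>*" using walk_rtrancl by fastforce
    have "step H \<subseteq> (step H')\<^sup>*"
    proof
      fix p assume "p \<in> step H"
      then obtain a b f where p: "p = (a, b)" "a \<in> verts H" "b \<in> verts H"
        "f \<in> edges H" "ends H f = {a, b}"
        unfolding step_def by auto
      show "p \<in> (step H')\<^sup>*"
      proof (cases "f = e")
        case True
        then have "(a, b) = (x, y) \<or> (a, b) = (y, x)" using p e by (auto simp: doubleton_eq_iff)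
        then show ?thesis using p yx sym_step_rtrancl[OF yx] by auto
      next
        case False
        then have "p \<in> step H'" using p unfolding step_def H'_def by auto
        then show ?thesis by blast
      qed
    qed
    then have sub: "(step H)\<^sup>* \<subseteq> (step H')\<^sup>*" by (rule rtrancl_subset_rtrancl)
    obtain v where v: "v \<in> verts H" using less.prems by (auto simp: connected_mgraph_def)
    then have "connected_mgraph H'"
      using less.prems(2) sub connected_mgraph_iff[of v H] connected_mgraph_iff[of v H']
      by (auto simp: H'_def)
    moreover have "card (edges H') < card (edges H)"
      using e less.prems(1) by (simp add: H'_def card_Diff1_less del: card_Diff_insert)
    ultimately obtain T where "subgraph T H'" "tree T" "verts T = verts H'"
      using less.hyps[of H'] less.prems by (auto simp: H'_def)
    from this(1) have "subgraph T H" unfolding subgraph_def H'_def by simp (metis Diff_subset subset_trans)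
    then show ?thesis using \<open>tree T\<close> \<open>verts T = verts H'\<close> by (auto simp: H'_def)
  qed
qed

section \<open>Rooted tree induced subgraphs as connected induced subgraphs\<close>

lemma induced_simps [simp]:
  "verts (induced G X) = X"
  "edges (induced G X) = {e \<in> edges G. ends G e \<subseteq> X}"
  "ends (induced G X) = ends G"
  by (simp_all add: induced_def)

text \<open>Passing from \<open>T\<close> to the subgraph induced on its vertices only adds edges,
  so connectivity is kept. Conversely, a spanning tree of a connected induced subgraph serves as
  \<open>T\<close>.\<close>

lemma rooted_tree_induced_subgraph_iff:
  assumes "finite (edges G)"
  shows "rooted_tree_induced_subgraph G v H \<longleftrightarrow>
    (\<exists>X. H = induced G X \<and> v \<in> X \<and> X \<subseteq> verts G \<and> connected_mgraph (induced G X))"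
    (is "?L \<longleftrightarrow> ?R")
proof
  assume ?L
  then obtain T where T: "subgraph T G" "tree T" "v \<in> verts T" "H = induced G (verts T)"
    unfolding rooted_tree_induced_subgraph_def by blast
  have "step T \<subseteq> step (induced G (verts T))"
    using T(1) by (intro step_mono) (auto simp: subgraph_def, blast)
  then have "(step T)\<^sup>* \<subseteq> (step (induced G (verts T)))\<^sup>*" by (rule rtrancl_mono)
  moreover have "\<forall>u\<in>verts T. (v, u) \<in> (step T)\<^sup>*"
    using T connected_mgraph_iff[of v T] by (auto simp: tree_def)
  ultimately have "connected_mgraph (induced G (verts T))"
    using T(3) connected_mgraph_iff[of v "induced G (verts T)"] by auto
  then show ?R using T by (auto simp: subgraph_def)
next
  assume ?R
  then obtain X where X: "H = induced G X" "v \<in> X" "X \<subseteq> verts G" "connected_mgraph (induced G X)"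
    by blast
  then obtain T where "subgraph T (induced G X)" "tree T" "verts T = X"
    using ex_spanning_tree[of "induced G X"] assms by auto
  then show ?L using X unfolding rooted_tree_induced_subgraph_def subgraph_def
    by (intro exI[of _ T]) auto
qed

section \<open>Isomorphisms of induced subgraphs\<close>

text \<open>Steps are preserved by the map, and injectivity on vertices lets them be lifted back; as
  \<open>v\<close> is fixed, reachability from \<open>v\<close> transfers both ways. One direction
  gives connected targets for elements of \<open>Tisg\<close>, the other connected domains for
  products.\<close>

lemma graph_iso_connected_iff:
  assumes iso: "graph_iso \<phi> H J" and v: "v \<in> verts H" "fst \<phi> v = Some v"
    and ends: "\<forall>e\<in>edges H. ends H e \<subseteq> verts H"
  shows "connected_mgraph H \<longleftrightarrow> connected_mgraph J"
proof -
  define f where "f = (\<lambda>x. the (fst \<phi> x))"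
  define g where "g = (\<lambda>e. the (snd \<phi> e))"
  have f: "bij_betw f (verts H) (verts J)" and g: "bij_betw g (edges H) (edges J)"
    and fg: "\<And>e. e \<in> edges H \<Longrightarrow> ends J (g e) = f ` ends H e" and fv: "f v = v"
    using iso v unfolding graph_iso_def f_def g_def by auto
  have inj: "inj_on f (verts H)" and im: "f ` verts H = verts J" and img: "g ` edges H = edges J"
    using f g by (auto simp: bij_betw_def)
  have vJ: "v \<in> verts J" using im v fv by force
  have fwd: "(f x, f y) \<in> (step J)\<^sup>*" if "(x, y) \<in> (step H)\<^sup>*" for x y
    using that
  proof (induction rule: rtrancl_induct)
    case (step y z)
    then obtain e where "e \<in> edges H" "ends H e = {y, z}" "y \<in> verts H" "z \<in> verts H"
      by (auto simp: step_def)
    then have "g e \<in> edges J" "ends J (g e) = {f y, f z}" "f y \<in> verts J" "f z \<in> verts J"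
      using fg img im by auto
    then have "(f y, f z) \<in> step J" unfolding step_def by auto
    then show ?case using step.IH by simp
  qed simp
  have bwd: "\<exists>x\<in>verts H. f x = w \<and> (v, x) \<in> (step H)\<^sup>*" if "(v, w) \<in> (step J)\<^sup>*" for w
    using that
  proof (induction rule: rtrancl_induct)
    case base
    then show ?case using v fv by auto
  next
    case (step y z)
    then obtain x where x: "x \<in> verts H" "f x = y" "(v, x) \<in> (step H)\<^sup>*" by auto
    obtain e' where e': "e' \<in> edges J" "ends J e' = {y, z}" "z \<in> verts J"
      using step.hyps by (auto simp: step_def)
    obtain e where e: "e \<in> edges H" "g e = e'" using e' img by (metis imageE)
    obtain t where t: "t \<in> verts H" "f t = z" using e' im by (metis imageE)
    \<comment> \<open>Only the images of the ends of \<open>e\<close> are known. Injectivity of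
      \<open>f\<close> recovers the ends themselves, once they are known to lie in
      \<open>verts H\<close>.\<close>
    have "f ` ends H e = f ` {x, t}" using fg[OF e(1)] e e' x t by auto
    moreover have "ends H e \<subseteq> verts H" "{x, t} \<subseteq> verts H" using ends e x t by auto
    ultimately have "ends H e = {x, t}" using inj inj_on_image_eq_iff by metis
    then have "(x, t) \<in> step H" using e x t by (auto simp: step_def)
    then show ?case using x t rtrancl.rtrancl_into_rtrancl[OF x(3)] by blast
  qed
  show ?thesis
    unfolding connected_mgraph_iff[OF v(1)] connected_mgraph_iff[OF vJ]
  proof
    assume "\<forall>u\<in>verts H. (v, u) \<in> (step H)\<^sup>*"
    then show "\<forall>u\<in>verts J. (v, u) \<in> (step J)\<^sup>*"
      using fwd im fv by (metis imageE)
  next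
    assume r: "\<forall>u\<in>verts J. (v, u) \<in> (step J)\<^sup>*"
    show "\<forall>u\<in>verts H. (v, u) \<in> (step H)\<^sup>*"
    proof
      fix u assume u: "u \<in> verts H"
      then have "(v, f u) \<in> (step J)\<^sup>*" using r im by auto
      from bwd[OF this] show "(v, u) \<in> (step H)\<^sup>*" using u inj by (auto dest: inj_onD)
    qed
  qed
qed

lemma graph_iso_comp:
  assumes "graph_iso \<phi> H J" "graph_iso \<psi> J K" "\<forall>e\<in>edges H. ends H e \<subseteq> verts H"
  shows "graph_iso (fst \<psi> \<circ>\<^sub>m fst \<phi>, snd \<psi> \<circ>\<^sub>m snd \<phi>) H K"
proof -
  define f where "f = (\<lambda>x. the (fst \<phi> x))"
  define g where "g = (\<lambda>e. the (snd \<phi> e))"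
  define f' where "f' = (\<lambda>x. the (fst \<psi> x))"
  define g' where "g' = (\<lambda>e. the (snd \<psi> e))"
  have f: "bij_betw f (verts H) (verts J)" and g: "bij_betw g (edges H) (edges J)"
    and fg: "\<And>e. e \<in> edges H \<Longrightarrow> ends J (g e) = f ` ends H e"
    and d: "dom (fst \<phi>) = verts H" "dom (snd \<phi>) = edges H"
    using assms(1) unfolding graph_iso_def f_def g_def by auto
  have f': "bij_betw f' (verts J) (verts K)" and g': "bij_betw g' (edges J) (edges K)"
    and fg': "\<And>e. e \<in> edges J \<Longrightarrow> ends K (g' e) = f' ` ends J e"
    and d': "dom (fst \<psi>) = verts J" "dom (snd \<psi>) = edges J"
    using assms(2) unfolding graph_iso_def f'_def g'_def by auto
  have fs: "fst \<phi> x = Some (f x)" "f x \<in> verts J" if "x \<in> verts H" for x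
    using d that f unfolding f_def by (force simp: bij_betw_def)+
  have gs: "snd \<phi> x = Some (g x)" "g x \<in> edges J" if "x \<in> edges H" for x
    using d that g unfolding g_def by (force simp: bij_betw_def)+
  have fs': "fst \<psi> x = Some (f' x)" if "x \<in> verts J" for x
    using d' that unfolding f'_def by force
  have gs': "snd \<psi> x = Some (g' x)" if "x \<in> edges J" for x
    using d' that unfolding g'_def by force
  have c1: "(fst \<psi> \<circ>\<^sub>m fst \<phi>) x = Some ((f' \<circ> f) x)" if "x \<in> verts H" for x
    using fs fs' that by (simp add: map_comp_def)
  have c2: "(snd \<psi> \<circ>\<^sub>m snd \<phi>) x = Some ((g' \<circ> g) x)" if "x \<in> edges H" for x
    using gs gs' that by (simp add: map_comp_def)
  have "dom (fst \<psi> \<circ>\<^sub>m fst \<phi>) = verts H"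
    using c1 d by (auto simp: map_comp_def split: option.splits)
  moreover have "dom (snd \<psi> \<circ>\<^sub>m snd \<phi>) = edges H"
    using c2 d by (auto simp: map_comp_def split: option.splits)
  moreover have "bij_betw (\<lambda>x. the ((fst \<psi> \<circ>\<^sub>m fst \<phi>) x)) (verts H) (verts K)"
    using bij_betw_trans[OF f f'] c1 by (simp cong: bij_betw_cong)
  moreover have "bij_betw (\<lambda>x. the ((snd \<psi> \<circ>\<^sub>m snd \<phi>) x)) (edges H) (edges K)"
    using bij_betw_trans[OF g g'] c2 by (simp cong: bij_betw_cong)
  moreover have "ends K (the ((snd \<psi> \<circ>\<^sub>m snd \<phi>) e)) = (\<lambda>x. the ((fst \<psi> \<circ>\<^sub>m fst \<phi>) x)) ` ends H e"
    if "e \<in> edges H" for e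
  proof -
    have "ends K (the ((snd \<psi> \<circ>\<^sub>m snd \<phi>) e)) = f' ` f ` ends H e"
      using that c2 fg fg' gs by simp
    also have "\<dots> = (\<lambda>x. the ((fst \<psi> \<circ>\<^sub>m fst \<phi>) x)) ` ends H e"
      unfolding image_image
    proof (rule image_cong[OF refl])
      fix x assume "x \<in> ends H e"
      then have "x \<in> verts H" using assms(3) that by blast
      then show "f' (f x) = the ((fst \<psi> \<circ>\<^sub>m fst \<phi>) x)" using c1 by simp
    qed
    finally show ?thesis .
  qed
  ultimately show ?thesis by (simp add: graph_iso_def)
qed

text \<open>\<open>D\<close> and \<open>E\<close> are preimages because the product is defined by
  preimages of its core. The point is that the preimage of the edges inside \<open>C\<close> is
  again the full edge set of an induced subgraph.\<close>

lemma graph_iso_restrict: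
  assumes iso: "graph_iso \<phi> (induced G X) (induced G Y)" and C: "C \<subseteq> Y"
    and D: "D = {x. \<exists>y\<in>C. fst \<phi> x = Some y}"
    and E: "E = {e. \<exists>f\<in>edges (induced G C). snd \<phi> e = Some f}"
  shows "D \<subseteq> X" "E = edges (induced G D)"
    "graph_iso (fst \<phi> |` D, snd \<phi> |` E) (induced G D) (induced G C)"
proof -
  define f where "f = (\<lambda>x. the (fst \<phi> x))"
  define g where "g = (\<lambda>e. the (snd \<phi> e))"
  have f: "bij_betw f X Y" and g: "bij_betw g (edges (induced G X)) (edges (induced G Y))"
    and fg: "\<And>e. e \<in> edges (induced G X) \<Longrightarrow> ends G (g e) = f ` ends G e"
    and d: "dom (fst \<phi>) = X" "dom (snd \<phi>) = edges (induced G X)"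
    using iso unfolding graph_iso_def f_def g_def by auto
  have fs: "fst \<phi> x = Some y \<longleftrightarrow> x \<in> X \<and> y = f x" for x y
    using d by (auto simp: f_def)
  have gs: "snd \<phi> x = Some y \<longleftrightarrow> x \<in> edges (induced G X) \<and> y = g x" for x y
  proof -
    have "x \<in> edges (induced G X) \<longleftrightarrow> snd \<phi> x \<noteq> None"
      unfolding d(2)[symmetric] by (simp add: domIff)
    then show ?thesis by (auto simp: g_def simp del: induced_simps)
  qed
  have D': "D = {x \<in> X. f x \<in> C}" unfolding D fs by auto
  then show DX: "D \<subseteq> X" by auto
  \<comment> \<open>The ends of \<open>g e\<close> are the images of the ends of \<open>e\<close>,
    so an edge lands inside \<open>C\<close> exactly when its ends lie in the preimage
    \<open>D\<close>.\<close>
  have gE: "g e \<in> edges (induced G C) \<longleftrightarrow> ends G e \<subseteq> D" if "e \<in> edges (induced G X)" for e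
  proof -
    have "g e \<in> edges G" "ends G e \<subseteq> X" using that g by (auto simp: bij_betw_def)
    then show ?thesis using fg[OF that] D' by auto
  qed
  show E': "E = edges (induced G D)"
  proof -
    have "E = {e \<in> edges (induced G X). g e \<in> edges (induced G C)}" unfolding E gs by blast
    also have "\<dots> = edges (induced G D)" using gE DX by auto
    finally show ?thesis .
  qed
  have "f ` D = C" using f C D' by (auto simp: bij_betw_def)
  then have fD: "bij_betw f D C" using bij_betw_subset[OF f DX] by auto
  have EX: "edges (induced G D) \<subseteq> edges (induced G X)" using DX by auto
  have "g ` edges (induced G D) = edges (induced G C)"
  proof
    show "g ` edges (induced G D) \<subseteq> edges (induced G C)"
    proof (rule image_subsetI)
      fix e assume "e \<in> edges (induced G D)"
      then show "g e \<in> edges (induced G C)" using gE[of e] EX by auto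
    qed
    show "edges (induced G C) \<subseteq> g ` edges (induced G D)"
    proof
      fix h assume h: "h \<in> edges (induced G C)"
      then have "h \<in> edges (induced G Y)" using C by auto
      then obtain e where "e \<in> edges (induced G X)" "h = g e"
        using g by (metis bij_betw_imp_surj_on imageE)
      then show "h \<in> g ` edges (induced G D)" using gE h by auto
    qed
  qed
  then have gD: "bij_betw g (edges (induced G D)) (edges (induced G C))"
    using bij_betw_subset[OF g EX] by auto
  have "ends G (g e) = f ` ends G e" if "e \<in> edges (induced G D)" for e
    by (rule fg) (rule subsetD[OF EX that])
  moreover have "bij_betw (\<lambda>x. the ((fst \<phi> |` D) x)) D C"
    using fD by (simp add: f_def cong: bij_betw_cong)
  moreover have "bij_betw (\<lambda>x. the ((snd \<phi> |` E) x)) (edges (induced G D)) (edges (induced G C))"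
    using gD unfolding E' by (simp add: g_def del: induced_simps cong: bij_betw_cong)
  moreover have "(\<lambda>x. the ((fst \<phi> |` D) x)) ` ends G e = f ` ends G e" if "e \<in> edges (induced G D)" for e
    using that by (intro image_cong) (auto simp: f_def restrict_map_def)
  moreover have "dom (fst \<phi> |` D) = D" "dom (snd \<phi> |` E) = E" using d DX EX unfolding E'
    by (simp_all add: Int_absorb1 del: induced_simps)
  moreover have "the ((snd \<phi> |` E) e) = g e" if "e \<in> edges (induced G D)" for e
    using that unfolding E' by (simp add: g_def)
  ultimately show "graph_iso (fst \<phi> |` D, snd \<phi> |` E) (induced G D) (induced G C)"
    unfolding graph_iso_def fst_conv snd_conv induced_simps(1,3) E'[symmetric] by metis
qed

section \<open>Closure of Tisg(G,v) under the product\<close>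

text \<open>An isomorphism fixing \<open>v\<close> carries connectivity and the root over to its
  target, so only the domain has to be checked.\<close>

lemma Tisg_iff:
  assumes "finite (edges G)"
  shows "\<phi> \<in> Tisg G v \<longleftrightarrow> (\<exists>X Y. v \<in> X \<and> X \<subseteq> verts G \<and> Y \<subseteq> verts G \<and>
    connected_mgraph (induced G X) \<and> graph_iso \<phi> (induced G X) (induced G Y) \<and> fst \<phi> v = Some v)"
    (is "?L \<longleftrightarrow> ?R")
proof
  assume ?L
  then show ?R unfolding Tisg_def rooted_tree_induced_subgraph_iff[OF assms] by blast
next
  assume ?R
  then obtain X Y where *: "v \<in> X" "X \<subseteq> verts G" "Y \<subseteq> verts G" "connected_mgraph (induced G X)"
    "graph_iso \<phi> (induced G X) (induced G Y)" "fst \<phi> v = Some v" by blast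
  then have "connected_mgraph (induced G Y)"
    using graph_iso_connected_iff[of \<phi> "induced G X" "induced G Y" v] by simp
  moreover have "v \<in> Y" using *(1,5,6) unfolding graph_iso_def bij_betw_def
    by (metis image_eqI induced_simps(1) option.sel)
  ultimately show ?L unfolding Tisg_def rooted_tree_induced_subgraph_iff[OF assms] using * by blast
qed

lemma graph_iso_ran:
  assumes "graph_iso \<phi> H J"
  shows "ran (fst \<phi>) = verts J" "ran (snd \<phi>) = edges J"
proof -
  have r: "ran m = (\<lambda>x. the (m x)) ` dom m" for m :: "'c \<rightharpoonup> 'd"
    by (force simp: ran_def dom_def image_def)
  show "ran (fst \<phi>) = verts J" "ran (snd \<phi>) = edges J"
    using assms unfolding r graph_iso_def bij_betw_def by auto
qed

text \<open>Two induced subgraphs of \<open>G\<close> have in common exactly the subgraph induced on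
  the common vertices, so a path lying in both is a path there. The core is thus spanned by a
  connected component.\<close>

lemma verts_comp_core:
  assumes "graph_iso \<phi> (induced G X) (induced G Y)" "graph_iso \<psi> (induced G Y') (induced G Z)"
    and "v \<in> Y \<inter> Y'"
  shows "verts (comp_core G v \<psi> \<phi>) = {u. (v, u) \<in> (step (induced G (Y \<inter> Y')))\<^sup>*}"
proof -
  have I: "Im_graph G \<phi> = induced G Y" "Dom_graph G \<psi> = induced G Y'"
    using assms graph_iso_ran[OF assms(1)]
    by (simp_all add: Im_graph_def Dom_graph_def induced_def graph_iso_def)
  have "path (induced G Y) vs es \<and> path (induced G Y') vs es \<longleftrightarrow> path (induced G (Y \<inter> Y')) vs es"
    for vs es
    by (auto simp: path_def walk_def)
  then have "verts (comp_core G v \<psi> \<phi>) =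
      {u. \<exists>vs es. path (induced G (Y \<inter> Y')) vs es \<and> hd vs = v \<and> last vs = u}"
    unfolding comp_core_def I induced_simps by blast
  also have "\<dots> = {u. (v, u) \<in> (step (induced G (Y \<inter> Y')))\<^sup>*}"
    using assms(3) walk_rtrancl rtrancl_path[of v _ "induced G (Y \<inter> Y')"]
    by (fastforce simp: path_def)
  finally show ?thesis .
qed

text \<open>Every vertex met on the way from \<open>v\<close> is itself reachable from
  \<open>v\<close>, so no step leaves \<open>C\<close>.\<close>

lemma connected_component:
  assumes "v \<in> X" "C = {u. (v, u) \<in> (step (induced G X))\<^sup>*}"
  shows "v \<in> C" "C \<subseteq> X" "connected_mgraph (induced G C)"
proof -
  show vC: "v \<in> C" using assms by simp
  show "C \<subseteq> X" using assms step_rtrancl_verts[of v _ "induced G X"] by auto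
  have "(v, u) \<in> (step (induced G C))\<^sup>*" if "(v, u) \<in> (step (induced G X))\<^sup>*" for u
    using that
  proof (induction rule: rtrancl_induct)
    case (step y z)
    then have "y \<in> C" "z \<in> C" using assms by auto
    then have "(y, z) \<in> step (induced G C)" using step.hyps by (auto simp: step_def)
    then show ?case using step.IH by simp
  qed simp
  then show "connected_mgraph (induced G C)"
    using vC assms connected_mgraph_iff[of v "induced G C"] by simp
qed

text \<open>Splits the restricted composite that defines the product into two restricted
  isomorphisms, to which \<open>graph_iso_comp\<close> applies.\<close>

lemma map_comp_restrict:
  assumes "A = {x. \<exists>y\<in>B. m x = Some y}"
  shows "(n \<circ>\<^sub>m m) |` A = (n |` B) \<circ>\<^sub>m (m |` A)"
  using assms by (auto simp: fun_eq_iff map_comp_def restrict_map_def split: option.splits)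

text \<open>The product factors through the core as \<open>D\<close> to \<open>C\<close> by \<phi>
  and \<open>C\<close> to \<open>W\<close> by \<psi>, both isomorphisms of induced subgraphs. The
  bound on the domain is what shows later that the maps living on \<open>v\<close> alone form an
  ideal.\<close>

lemma tisg_mult:
  assumes fin: "finite (edges G)" and "\<phi> \<in> Tisg G v" "\<psi> \<in> Tisg G v"
  shows "tisg_mult G v \<psi> \<phi> \<in> Tisg G v"
    and "dom (fst (tisg_mult G v \<psi> \<phi>)) \<subseteq> {x. \<exists>y\<in>dom (fst \<psi>). fst \<phi> x = Some y}"
proof -
  obtain X Y where 1: "v \<in> X" "X \<subseteq> verts G" "Y \<subseteq> verts G" "connected_mgraph (induced G X)"
    "graph_iso \<phi> (induced G X) (induced G Y)" "fst \<phi> v = Some v"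
    using assms(2) unfolding Tisg_iff[OF fin] by blast
  obtain Y' Z where 2: "v \<in> Y'" "Y' \<subseteq> verts G" "Z \<subseteq> verts G" "connected_mgraph (induced G Y')"
    "graph_iso \<psi> (induced G Y') (induced G Z)" "fst \<psi> v = Some v"
    using assms(3) unfolding Tisg_iff[OF fin] by blast
  have "v \<in> Y" using 1 graph_iso_ran(1)[OF 1(5)] by (metis induced_simps(1) ranI)
  then have vYY: "v \<in> Y \<inter> Y'" using 2 by simp
  define C where "C = verts (comp_core G v \<psi> \<phi>)"
  note C' = verts_comp_core[OF 1(5) 2(5) vYY, folded C_def]
  note C = connected_component[OF vYY C']
  have Eeq: "edges (comp_core G v \<psi> \<phi>) = edges (induced G C)"
    unfolding C_def comp_core_def by simp
  define D where "D = {x. \<exists>y\<in>C. fst \<phi> x = Some y}"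
  define E where "E = {e. \<exists>f\<in>edges (induced G C). snd \<phi> e = Some f}"
  have CY: "C \<subseteq> Y" "C \<subseteq> Y'" using C by auto
  note r1 = graph_iso_restrict[OF 1(5) CY(1) D_def E_def]
  define W where "W = (\<lambda>x. the (fst \<psi> x)) ` C"
  have dom\<psi>: "dom (fst \<psi>) = Y'" and bij: "bij_betw (\<lambda>x. the (fst \<psi> x)) Y' Z"
    using 2 by (auto simp: graph_iso_def)
  have WZ: "W \<subseteq> Z" using bij CY by (auto simp: W_def bij_betw_def)
  \<comment> \<open>\<open>graph_iso_restrict\<close> starts from a subset of the target, whereas
    \<psi> is to be cut down to the subset \<open>C\<close> of its domain. Injectivity of \<psi>
    makes \<open>C\<close> the full preimage of its image \<open>W\<close>.\<close>
  have CW: "C = {x. \<exists>y\<in>W. fst \<psi> x = Some y}"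
  proof -
    have "x \<in> C" if "fst \<psi> x = Some (the (fst \<psi> c))" "c \<in> C" for x c
    proof -
      have "x \<in> Y'" using that dom\<psi> by auto
      moreover have "c \<in> Y'" "inj_on (\<lambda>x. the (fst \<psi> x)) Y'"
        using that CY bij by (auto simp: bij_betw_def)
      ultimately have "x = c" using that by (metis inj_onD option.sel)
      then show ?thesis using that by simp
    qed
    moreover have "\<exists>y\<in>W. fst \<psi> x = Some y" if "x \<in> C" for x
      using that CY dom\<psi> unfolding W_def by (force simp: dom_def)
    ultimately show ?thesis unfolding W_def by auto
  qed
  note r2 = graph_iso_restrict[OF 2(5) WZ CW refl]
  have prod: "tisg_mult G v \<psi> \<phi> =
      ((fst \<psi> |` C) \<circ>\<^sub>m (fst \<phi> |` D), (snd \<psi> |` edges (induced G C)) \<circ>\<^sub>m (snd \<phi> |` E))"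
    unfolding tisg_mult_def C_def[symmetric] Eeq D_def[symmetric] E_def[symmetric]
    by (simp only: map_comp_restrict[OF D_def] map_comp_restrict[OF E_def])
  have iso: "graph_iso (tisg_mult G v \<psi> \<phi>) (induced G D) (induced G W)"
    using graph_iso_comp[OF r1(3) r2(3)[unfolded r2(2)]] unfolding prod by simp
  have vD: "v \<in> D" using C 1 by (auto simp: D_def)
  \<comment> \<open>\<open>C\<close> is connected as a component of \<open>v\<close>; the
    isomorphism from \<open>D\<close> onto \<open>C\<close> carries this back to the domain.\<close>
  have "connected_mgraph (induced G D)"
    using graph_iso_connected_iff[OF r1(3), of v] C vD 1 by simp
  moreover have "fst (tisg_mult G v \<psi> \<phi>) v = Some v"
    unfolding prod using vD C 1 2 by (simp add: map_comp_def)
  moreover have "D \<subseteq> verts G" "W \<subseteq> verts G" using r1(1) 1(2) WZ 2(3) by auto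
  ultimately show "tisg_mult G v \<psi> \<phi> \<in> Tisg G v"
    unfolding Tisg_iff[OF fin] using iso vD by (intro exI[of _ D] exI[of _ W] conjI)
  have "dom (fst (tisg_mult G v \<psi> \<phi>)) = D" using iso by (simp add: graph_iso_def)
  then show "dom (fst (tisg_mult G v \<psi> \<phi>)) \<subseteq> {x. \<exists>y\<in>dom (fst \<psi>). fst \<phi> x = Some y}"
    using CY dom\<psi> by (auto simp: D_def)
qed

lemma bij_betw_restrict_Some: "bij_betw (\<lambda>x. the ((Some |` A) x)) A A"
  by (auto simp: bij_betw_def inj_on_def)

lemma identity_in_Tisg:
  assumes "finite (edges G)" "v \<in> X" "X \<subseteq> verts G" "connected_mgraph (induced G X)"
  shows "(Some |` X, Some |` edges (induced G X)) \<in> Tisg G v"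
proof -
  have "(\<lambda>x. the ((Some |` X) x)) ` ends G e = ends G e" if "ends G e \<subseteq> X" for e
    using that by (force simp: restrict_map_def)
  then have "graph_iso (Some |` X, Some |` edges (induced G X)) (induced G X) (induced G X)"
    unfolding graph_iso_def by (simp add: bij_betw_restrict_Some)
  moreover have "fst (Some |` X, Some |` edges (induced G X)) v = Some v" using assms(2) by simp
  ultimately show ?thesis
    unfolding Tisg_iff[OF assms(1)] using assms(2-4) by (intro exI[of _ X] conjI)
qed

text \<open>Needed when the outer factor of a product lives on \<open>v\<close> alone: the inner
  factor can then enter its domain only from \<open>v\<close>.\<close>

lemma Tisg_inj:
  assumes "\<phi> \<in> Tisg G v" "fst \<phi> x = Some v"
  shows "x = v"
proof -
  obtain H J where "graph_iso \<phi> H J" and v: "fst \<phi> v = Some v"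
    using assms(1) unfolding Tisg_def by blast
  then have "inj_on (\<lambda>x. the (fst \<phi> x)) (dom (fst \<phi>))"
    by (simp add: graph_iso_def bij_betw_def)
  from inj_onD[OF this, of x v] show ?thesis using v assms(2) by auto
qed

section \<open>Lattices of sets\<close>

text \<open>Separates the order theory from the graphs. The empty family puts \<open>{}\<close> into
  \<open>F\<close> as bottom element, and closure under arbitrary unions computes the join of any
  set of atoms.\<close>

locale set_lattice =
  fixes F :: "'a set set" and L :: "'a set gorder"
  assumes L_def: "L = \<lparr>carrier = F, eq = (=), le = (\<subseteq>)\<rparr>"
    and Int: "A \<in> F \<Longrightarrow> B \<in> F \<Longrightarrow> A \<inter> B \<in> F"
    and Union: "M \<subseteq> F \<Longrightarrow> \<Union>M \<in> F"
begin

lemma partial_order: "partial_order L"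
  by unfold_locales (auto simp: L_def)

lemma least_Union: "M \<subseteq> F \<Longrightarrow> least L (\<Union>M) (Upper L M)"
  using Union[of M] by (auto simp: least_def Upper_def L_def)

lemma greatest_Int: "A \<in> F \<Longrightarrow> B \<in> F \<Longrightarrow> greatest L (A \<inter> B) (Lower L {A, B})"
  using Int[of A B] by (auto simp: greatest_def Lower_def L_def)

lemma lattice: "lattice L"
proof -
  interpret partial_order L by (rule partial_order)
  show ?thesis
  proof
    fix x y assume "x \<in> carrier L" "y \<in> carrier L"
    then have "x \<in> F" "y \<in> F" by (auto simp: L_def)
    then show "\<exists>s. least L s (Upper L {x, y})" "\<exists>s. greatest L s (Lower L {x, y})"
      using least_Union[of "{x, y}"] greatest_Int by blast+
  qed
qed

text \<open>Join, meet and bottom are Hilbert choices, so their values are pinned down by uniqueness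
  of least and greatest elements.\<close>

lemma join_eq: "A \<in> F \<Longrightarrow> B \<in> F \<Longrightarrow> A \<squnion>\<^bsub>L\<^esub> B = A \<union> B"
proof -
  assume "A \<in> F" "B \<in> F"
  interpret partial_order L by (rule partial_order)
  have l: "least L (A \<union> B) (Upper L {A, B})"
    using least_Union[of "{A, B}"] \<open>A \<in> F\<close> \<open>B \<in> F\<close> by simp
  show ?thesis unfolding join_def sup_def
    using l least_unique[OF _ l] by (rule some_equality)
qed

lemma meet_eq: "A \<in> F \<Longrightarrow> B \<in> F \<Longrightarrow> A \<sqinter>\<^bsub>L\<^esub> B = A \<inter> B"
proof -
  assume "A \<in> F" "B \<in> F"
  interpret partial_order L by (rule partial_order)
  have l: "greatest L (A \<inter> B) (Lower L {A, B})"
    using greatest_Int \<open>A \<in> F\<close> \<open>B \<in> F\<close> by simp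
  show ?thesis unfolding meet_def inf_def
    using l greatest_unique[OF _ l] by (rule some_equality)
qed

lemma bottom_eq: "\<bottom>\<^bsub>L\<^esub> = {}"
proof -
  interpret partial_order L by (rule partial_order)
  have l: "least L {} (carrier L)"
    using Union[of "{}"] by (auto simp: least_def L_def)
  show ?thesis unfolding bottom_def
    using l least_unique[OF _ l] by (rule some_equality)
qed

lemma covers_iff: "covers L A B \<longleftrightarrow> A \<in> F \<and> B \<in> F \<and> B \<subset> A \<and> \<not> (\<exists>C\<in>F. B \<subset> C \<and> C \<subset> A)"
  unfolding covers_def lless_def by (auto simp: L_def)

lemma semimodular: "semimodular_lattice L"
  unfolding semimodular_lattice_def
proof (intro conjI ballI impI)
  fix A B assume "A \<in> carrier L" "B \<in> carrier L" and c: "covers L A (A \<sqinter>\<^bsub>L\<^esub> B)"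
  then have AB: "A \<in> F" "B \<in> F" by (auto simp: L_def)
  from c have c: "A \<inter> B \<subset> A" "\<And>C. C \<in> F \<Longrightarrow> A \<inter> B \<subset> C \<Longrightarrow> \<not> C \<subset> A"
    unfolding covers_iff meet_eq[OF AB] by blast+
  have "\<not> (B \<subset> C \<and> C \<subset> A \<union> B)" if "C \<in> F" for C
  proof
    assume "B \<subset> C \<and> C \<subset> A \<union> B"
    \<comment> \<open>A point of \<open>C\<close> outside \<open>B\<close> lies in \<open>A\<close>,
      which makes the first inclusion strict; a point of \<open>A \<union> B\<close> outside
      \<open>C\<close> is not in \<open>B\<close>, hence lies in \<open>A\<close>, which makes the
      second strict.\<close>
    then have "A \<inter> B \<subset> A \<inter> C" "A \<inter> C \<subset> A" by auto
    then show False using c(2) Int[OF AB(1) that] by blast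
  qed
  moreover have "A \<union> B \<in> F" using Union[of "{A, B}"] AB by simp
  ultimately show "covers L (A \<squnion>\<^bsub>L\<^esub> B) B"
    unfolding covers_iff join_eq[OF AB] using AB c(1) by blast
qed (rule lattice)

lemma not_atomic:
  assumes "S \<in> F" "J \<in> F" "x \<in> S" "x \<notin> J"
    and meets: "\<And>A. A \<in> F \<Longrightarrow> A \<noteq> {} \<Longrightarrow> A \<inter> J \<noteq> {}"
  shows "\<not> atomic_lattice L"
proof
  assume "atomic_lattice L"
  then obtain M where M: "M \<subseteq> atoms L" "least L S (Upper L M)"
    using \<open>S \<in> F\<close> unfolding atomic_lattice_def by (auto simp: L_def)
  have MF: "M \<subseteq> F" using M(1) unfolding atoms_def covers_iff by auto
  interpret partial_order L by (rule partial_order)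
  have "S = \<Union>M" using least_unique[OF M(2) least_Union[OF MF]] by simp
  then obtain A where A: "A \<in> M" "x \<in> A" using \<open>x \<in> S\<close> by auto
  then have "covers L A {}" using M(1) by (auto simp: atoms_def bottom_eq)
  \<comment> \<open>To be used with \<open>C = A \<inter> J\<close>, which is nonempty and misses
    \<open>x\<close>, hence lies strictly between \<open>{}\<close> and the atom
    \<open>A\<close>.\<close>
  then have "C \<notin> F \<or> C = {} \<or> \<not> C \<subset> A" for C unfolding covers_iff by auto
  moreover have "A \<inter> J \<in> F" "A \<inter> J \<noteq> {}" using A MF Int meets \<open>J \<in> F\<close> by blast+
  moreover have "A \<inter> J \<subset> A" using A \<open>x \<notin> J\<close> by auto
  ultimately show False by blast
qed

end

section \<open>The ideals of Tisg(G,v)\<close>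

lemma set_lattice_ideals:
  "set_lattice {I. semigroup_ideal S m I} \<lparr>carrier = {I. semigroup_ideal S m I}, eq = (=), le = (\<subseteq>)\<rparr>"
proof
  fix M assume M: "M \<subseteq> {I. semigroup_ideal S m I}"
  then have "semigroup_ideal S m I" if "I \<in> M" for I using that by auto
  \<comment> \<open>A product stays in whichever member of \<open>M\<close> contains the factor
    \<open>x\<close>.\<close>
  then have "\<Union>M \<subseteq> S" "\<And>s x. s \<in> S \<Longrightarrow> x \<in> \<Union>M \<Longrightarrow> m s x \<in> \<Union>M \<and> m x s \<in> \<Union>M"
    unfolding semigroup_ideal_def by blast+
  then show "\<Union>M \<in> {I. semigroup_ideal S m I}" by (simp add: semigroup_ideal_def)
qed (auto simp: semigroup_ideal_def)

theorem theorem4p22: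
  fixes G :: "('v, 'e) mgraph" and v :: 'v
  assumes "finite_mgraph G" and "v \<in> verts G"
  shows "semimodular_lattice (ideal_poset G v) \<and>
    (connected_mgraph G \<and> card (verts G) > 2 \<longrightarrow> \<not> atomic_lattice (ideal_poset G v))"
proof (intro conjI impI)
  let ?S = "Tisg G v" and ?m = "tisg_mult G v"
  interpret set_lattice "{I. semigroup_ideal ?S ?m I}" "ideal_poset G v"
    unfolding ideal_poset_def by (rule set_lattice_ideals)
  show "semimodular_lattice (ideal_poset G v)" by (rule semimodular)
  assume conn: "connected_mgraph G \<and> card (verts G) > 2"
  have fin: "finite (edges G)" using assms by (simp add: finite_mgraph_def)
  note mult = tisg_mult[OF fin]
  \<comment> \<open>Elements of \<open>J\<close> may still permute loops at \<open>v\<close>, so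
    \<open>J\<close> can have more than one element.\<close>
  define J where "J = {\<phi> \<in> ?S. dom (fst \<phi>) \<subseteq> {v}}"
  have S: "semigroup_ideal ?S ?m ?S" using mult(1) by (auto simp: semigroup_ideal_def)
  \<comment> \<open>If \<phi> lives on \<open>v\<close>, so does the product. If \<psi> does, the
    product is defined only where \<phi> takes the value \<open>v\<close>, which is at
    \<open>v\<close>.\<close>
  have mJ: "?m \<psi> \<phi> \<in> J" if "\<phi> \<in> ?S" "\<psi> \<in> ?S" "\<phi> \<in> J \<or> \<psi> \<in> J" for \<phi> \<psi>
    using mult[OF that(1,2)] that(3) Tisg_inj[OF that(1)] unfolding J_def by blast
  then have J: "semigroup_ideal ?S ?m J" by (auto simp: semigroup_ideal_def J_def)
  let ?id = "\<lambda>X. (Some |` X, Some |` edges (induced G X))"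
  have "connected_mgraph (induced G {v})" using connected_mgraph_iff[of v "induced G {v}"] by simp
  then have "?id {v} \<in> ?S" using identity_in_Tisg[OF fin, of v "{v}"] assms by simp
  then have idv: "?id {v} \<in> J" by (auto simp: J_def dom_def restrict_map_def)
  have "step G \<subseteq> step (induced G (verts G))" by (auto simp: step_def)
  then have "connected_mgraph (induced G (verts G))"
    using conn connected_mgraph_iff[of v G] connected_mgraph_iff[of v "induced G (verts G)"]
      rtrancl_mono[of "step G"] assms(2) by auto
  then have idG: "?id (verts G) \<in> ?S" using identity_in_Tisg[OF fin] assms by simp
  \<comment> \<open>A vertex other than \<open>v\<close> keeps the identity of \<open>G\<close> out
    of \<open>J\<close>; this identity witnesses that the ideal \<open>?S\<close> is not a join of
    atoms.\<close>
  have "\<not> verts G \<subseteq> {v}"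
  proof
    assume "verts G \<subseteq> {v}"
    then have "card (verts G) \<le> 1" using card_mono[of "{v}"] by fastforce
    then show False using conn by simp
  qed
  then have "?id (verts G) \<notin> J" by (simp add: J_def)
  moreover have "A \<inter> J \<noteq> {}" if A: "semigroup_ideal ?S ?m A" "A \<noteq> {}" for A
  proof -
    obtain \<phi> where "\<phi> \<in> A" "\<phi> \<in> ?S" using A by (auto simp: semigroup_ideal_def)
    \<comment> \<open>The product lies in \<open>A\<close> because of its factor \<phi> and in
      \<open>J\<close> because of the other factor.\<close>
    then have "?m \<phi> (?id {v}) \<in> A \<inter> J"
      using A mJ idv by (auto simp: semigroup_ideal_def J_def)
    then show ?thesis by blast
  qed
  ultimately show "\<not> atomic_lattice (ideal_poset G v)"
    using not_atomic[of ?S J] S J idG by simp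
qed

end
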